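(* Let $(A,B)$ be a suitable pair of sequences of integers that are all greater than $1$, and let $S=\langle C(A,B)\rangle$ be the numerical semigroup generated by the compound sequence $C(A,B)$. Then $S$ has at least as many odd gaps as even gaps, i.e. $O(G(S))\ge E(G(S))$. Furthermore, the following are equivalent: (1) $O(G(S))=E(G(S))$. (2) All terms in the compound sequence $C(A,B)$ are odd. (3) All terms in the sequences $A$ and $B$ are odd.
   Context: $\mathbb{N}$ is the set of positive integers and $\mathbb{N}_0$ the set of nonnegative integers. A numerical semigroup $S$ is a submonoid of $(\mathbb{N}_0,+)$ with finite complement; $G(S)=\mathbb{N}_0\setminus S$ is its (finite) set of gaps. For a sequence of positive integers $(n_0,\dots,n_p)$, $\langle n_0,\dots,n_p\rangle$ is the set of all $\mathbb{N}_0$-linear combinations of its terms; it is a numerical semigroup iff $\gcd(n_0,\dots,n_p)=1$. Compound sequence: for $p\in\mathbb{N}_0$ and $A=(a_1,\dots,a_p),B=(b_1,\dots,b_p)\in\mathbb{N}^p$, $(A,B)$ is a suitable pair if $\gcd(a_i,b_j)=1$ for all $i\ge j$. Given a suitable pair, the compound sequence $C(A,B)=(n_0,\dots,n_p)$ is defined by $n_0=a_1a_2\cdots a_p$ and $n_i=n_{i-1}b_i/a_i$ for $1\le i\le p$ (so $n_i=b_1\cdots b_i a_{i+1}\cdots a_p$). It is known that $\gcd(n_0,\dots,n_p)=1$, so $\langle C(A,B)\rangle$ is a numerical semigroup. For a finite set $X$ of integers, $O(X)$ (resp. $E(X)$) is the number of odd (resp. even) integers in $X$. *)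

theory Defs
  imports Main "HOL-Computational_Algebra.Primes"
begin

section \<open>Numerical semigroups\<close>

definition numerical_semigroup :: "nat set \<Rightarrow> bool" where
  "numerical_semigroup S \<longleftrightarrow> 0 \<in> S \<and> (\<forall>x\<in>S. \<forall>y\<in>S. x + y \<in> S) \<and> finite (UNIV - S)"

definition gaps :: "nat set \<Rightarrow> nat set" where
  "gaps S = UNIV - S"

definition generated :: "nat list \<Rightarrow> nat set" where
  "generated ns = {x. \<exists>c :: nat \<Rightarrow> nat. x = (\<Sum>i<length ns. c i * ns ! i)}"

text \<open>Only meaningful for finite sets, because \<^const>\<open>card\<close> of an infinite set is 0;
  \<open>finite_gaps_compound\<close> below gives the finiteness needed here.\<close>

definition odd_count :: "nat set \<Rightarrow> nat" where
  "odd_count X = card {x \<in> X. odd x}"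

definition even_count :: "nat set \<Rightarrow> nat" where
  "even_count X = card {x \<in> X. even x}"


section \<open>Compound sequences\<close>

text \<open>Lists are indexed from 0, so \<open>A ! i\<close> is the paper's \<open>a\<close> with index \<open>i + 1\<close>,
  and the length \<open>p\<close> may be 0.\<close>

definition suitable_pair :: "nat list \<Rightarrow> nat list \<Rightarrow> bool" where
  "suitable_pair A B \<longleftrightarrow>
     length A = length B \<and> (\<forall>a\<in>set A. a > 0) \<and> (\<forall>b\<in>set B. b > 0) \<and>
     (\<forall>i<length A. \<forall>j\<le>i. coprime (A ! i) (B ! j))"

text \<open>The division on \<^typ>\<open>nat\<close> is exact for \<open>i < length A\<close>, see \<open>compound_term_eq\<close>
  and \<open>compound_term_Suc_exact\<close>.\<close>

primrec compound_term :: "nat list \<Rightarrow> nat list \<Rightarrow> nat \<Rightarrow> nat" where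
  "compound_term A B 0 = prod_list A"
| "compound_term A B (Suc i) = compound_term A B i * B ! i div A ! i"

definition compound_sequence :: "nat list \<Rightarrow> nat list \<Rightarrow> nat list" where
  "compound_sequence A B = map (compound_term A B) [0..<Suc (length A)]"

lemma compound_term_eq:
  assumes "suitable_pair A B" "i \<le> length A"
  shows "compound_term A B i = prod_list (take i B) * prod_list (drop i A)"
  using assms(2)
proof (induction i)
  case (Suc i)
  have i: "i < length A" "i < length B" "A ! i > 0"
    using Suc.prems assms(1) by (auto simp: suitable_pair_def)
  have "drop i A = A ! i # drop (Suc i) A" "take (Suc i) B = take i B @ [B ! i]"
    using i by (auto simp: Cons_nth_drop_Suc take_Suc_conv_app_nth)
  then show ?case
    using Suc i by (simp add: mult.assoc mult.left_commute[of "A ! i"])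
qed simp

lemma compound_term_Suc_exact:
  assumes "suitable_pair A B" "i < length A"
  shows "compound_term A B (Suc i) * A ! i = compound_term A B i * B ! i"
proof -
  have "i < length B" using assms by (auto simp: suitable_pair_def)
  then have "drop i A = A ! i # drop (Suc i) A" "take (Suc i) B = take i B @ [B ! i]"
    using assms(2) by (auto simp: Cons_nth_drop_Suc take_Suc_conv_app_nth)
  then show ?thesis
    using compound_term_eq[OF assms(1), of i] compound_term_eq[OF assms(1), of "Suc i"] assms(2)
    by (simp del: compound_term.simps)
qed

lemma prime_dvd_prod_list_nat:
  "prime (q::nat) \<Longrightarrow> q dvd prod_list xs \<Longrightarrow> \<exists>x\<in>set xs. q dvd x"
  by (induction xs) (auto simp: prime_dvd_mult_iff)

lemma compound_common_divisor:
  assumes AB: "suitable_pair A B" and d: "\<And>n. n \<in> set (compound_sequence A B) \<Longrightarrow> d dvd n"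
  shows "d = 1"
proof (rule ccontr)
  assume "d \<noteq> 1"
  then obtain q where q: "prime q" "q dvd d" using prime_factor_nat by blast
  have dv: "q dvd prod_list (take i B) * prod_list (drop i A)" if "i \<le> length A" for i
  proof -
    have "compound_term A B i \<in> set (compound_sequence A B)"
      using that by (auto simp: compound_sequence_def simp del: upt_Suc)
    then show ?thesis using d q(2) dvd_trans compound_term_eq[OF AB that] by metis
  qed
  define K where "K = {k. k < length A \<and> q dvd A ! k}"
  have "K \<noteq> {}"
    using dv[of 0] prime_dvd_prod_list_nat[OF q(1), of A] by (auto simp: K_def in_set_conv_nth)
  moreover have "finite K" by (simp add: K_def)
  ultimately have k: "Max K \<in> K" and mx: "\<And>j. j \<in> K \<Longrightarrow> j \<le> Max K" by auto
  let ?k = "Max K"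
  have kl: "?k < length A" "q dvd A ! ?k" using k by (auto simp: K_def)
  from dv[of "Suc ?k"] kl q(1) consider "q dvd prod_list (take (Suc ?k) B)" | "q dvd prod_list (drop (Suc ?k) A)"
    by (auto simp: prime_dvd_mult_iff)
  then show False
  proof cases
    case 1
    then obtain b where "b \<in> set (take (Suc ?k) B)" "q dvd b"
      using prime_dvd_prod_list_nat[OF q(1)] by blast
    then obtain j where "j \<le> ?k" "q dvd B ! j"
      by (auto simp: in_set_conv_nth less_Suc_eq_le)
    moreover have "coprime (A ! ?k) (B ! j)" 
      using AB kl \<open>j \<le> ?k\<close> by (auto simp: suitable_pair_def)
    ultimately show False using kl q(1) by (metis coprime_common_divisor not_prime_unit)
  next
    case 2
    then obtain a where "a \<in> set (drop (Suc ?k) A)" "q dvd a"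
      using prime_dvd_prod_list_nat[OF q(1)] by blast
    then obtain j where "j < length A - Suc ?k" "q dvd A ! (Suc ?k + j)"
      by (auto simp: in_set_conv_nth)
    then have "Suc ?k + j \<in> K" by (auto simp: K_def)
    then show False using mx by fastforce
  qed
qed

lemma generated_0: "0 \<in> generated ns"
  unfolding generated_def by (auto intro: exI[of _ "\<lambda>_. 0"])

lemma generated_add: "x \<in> generated ns \<Longrightarrow> y \<in> generated ns \<Longrightarrow> x + y \<in> generated ns"
proof -
  assume "x \<in> generated ns" "y \<in> generated ns"
  then obtain c d where "x = (\<Sum>i<length ns. c i * ns ! i)" "y = (\<Sum>i<length ns. d i * ns ! i)"
    by (auto simp: generated_def)
  then have "x + y = (\<Sum>i<length ns. (c i + d i) * ns ! i)"
    by (simp add: sum.distrib distrib_right)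
  then show ?thesis by (auto simp: generated_def intro: exI[of _ "\<lambda>i. c i + d i"])
qed

lemma generated_mult: "x \<in> generated ns \<Longrightarrow> (k::nat) * x \<in> generated ns"
  by (induction k) (auto simp: generated_0 generated_add)

lemma set_subset_generated: "set ns \<subseteq> generated ns"
proof
  fix n assume "n \<in> set ns"
  then obtain k where k: "k < length ns" "n = ns ! k" by (auto simp: in_set_conv_nth)
  then have "n = (\<Sum>i<length ns. (if i = k then 1 else 0) * ns ! i)"
    by (simp add: if_distrib[of "\<lambda>x. x * _"] cong: if_cong)
  then show "n \<in> generated ns" by (auto simp: generated_def)
qed

lemma finite_complement_generated:
  assumes "\<And>d. (\<And>n. n \<in> set ns \<Longrightarrow> d dvd n) \<Longrightarrow> d = (1::nat)"
  shows "finite (UNIV - generated ns)"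
proof -
  let ?S = "generated ns"
  define P where "P d \<longleftrightarrow> d > 0 \<and> (\<exists>x\<in>?S. x + d \<in> ?S)" for d
  have "\<exists>m\<in>set ns. m > 0"
  proof (rule ccontr)
    assume "\<not> ?thesis"
    then have "0 = (1::nat)" by (intro assms) auto
    then show False by simp
  qed
  then obtain m where m: "m \<in> set ns" "m > 0" by blast
  then have "m \<in> ?S" using set_subset_generated by blast
  then have "P m" unfolding P_def using m(2) generated_0[of ns] by (intro conjI bexI[of _ 0]) simp_all
  define d where "d = (LEAST d. P d)"
  have Pd: "P d" and least: "\<And>e. P e \<Longrightarrow> d \<le> e"
    unfolding d_def using \<open>P m\<close> by (auto intro: LeastI Least_le)
  then obtain x where x: "d > 0" "x \<in> ?S" "x + d \<in> ?S" by (auto simp: P_def)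
  have "d dvd n" if "n \<in> set ns" for n
  proof (rule ccontr)
    assume "\<not> d dvd n"
    then have "n mod d > 0" by (simp add: dvd_eq_mod_eq_0)
    have "(n div d) * (x + d) \<in> ?S" "n + (n div d) * x \<in> ?S"
      using x that set_subset_generated by (auto intro!: generated_add generated_mult)
    moreover have "n + (n div d) * x = (n div d) * (x + d) + n mod d"
      by (simp add: algebra_simps)
    ultimately have "P (n mod d)" using \<open>n mod d > 0\<close> by (auto simp: P_def)
    then have "d \<le> n mod d" by (rule least)
    then show False using x(1) by (meson mod_less_divisor not_le)
  qed
  then have "d = 1" using assms by blast
  have "n \<in> ?S" if n: "n \<ge> x * x" for n
  proof (cases "x = 0")
    case True
    then show ?thesis using generated_mult[of 1 ns n] x \<open>d = 1\<close> by simp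
  next
    case False
    have "n mod x < x" using False by simp
    moreover have "x \<le> n div x" using n False by (simp add: less_eq_div_iff_mult_less_eq)
    ultimately have le: "n mod x \<le> n div x" by simp
    have "n = (n div x) * x + n mod x" by simp
    also have "\<dots> = (n div x - n mod x) * x + (n mod x) * (x + 1)"
    proof -
      obtain e where e: "n div x = n mod x + e" using le le_Suc_ex by blast
      show ?thesis unfolding e by (simp add: algebra_simps)
    qed
    finally show ?thesis
      using x \<open>d = 1\<close> by (metis generated_add generated_mult)
  qed
  then have "UNIV - ?S \<subseteq> {..<x * x}" by (meson DiffE lessThan_iff not_le subsetI)
  then show ?thesis using finite_subset by blast
qed

theorem numerical_semigroup_compound:
  assumes "suitable_pair A B"
  shows "numerical_semigroup (generated (compound_sequence A B))"
  using finite_complement_generated[of "compound_sequence A B"] compound_common_divisor[OF assms]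
  by (auto simp: numerical_semigroup_def generated_0 generated_add)

corollary finite_gaps_compound:
  "suitable_pair A B \<Longrightarrow> finite (gaps (generated (compound_sequence A B)))"
  using numerical_semigroup_compound by (simp add: numerical_semigroup_def gaps_def)

end

theory Submission
  imports Defs "HOL-Number_Theory.Cong"
begin

text \<open>Write $m = b_1 \cdots b_p$ and $a = a_p$. Dropping the last entries of $A$ and $B$ exhibits
  $S$ as the gluing $a S' + m {\bf N}_0$, where $a$ and $m$ are coprime and $m \in S'$. Each integer
  is $jm + ax$ for a unique $0 \le j < a$, and it lies in $S$ iff $x \in S'$; so the gaps of $S$ are
  the $jm + ax$ with $x$ a gap of $S'$, together with the nonnegative $jm - ay$ with $y \ge 1$.
  Let $\Delta$ be the number of even gaps minus the number of odd gaps, i.e. the sum of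
  $(-1)^x$ over the gaps. Then $2 \Delta(S)$ is $1 - m$ if $a$ is even,
  $2 a \Delta(S') + 1 - a$ if $m$ is even, and $2 \Delta(S')$ if both are odd, and the theorem
  follows by induction on $p$.\<close>

section \<open>Signed counting of gaps\<close>

definition parity_sum :: "nat set \<Rightarrow> int" where
  "parity_sum X = (\<Sum>x\<in>X. (-1) ^ x)"

lemma parity_sum_eq:
  assumes "finite X"
  shows "parity_sum X = int (even_count X) - int (odd_count X)"
proof -
  have "parity_sum X = (\<Sum>x\<in>{x\<in>X. even x}. (-1) ^ x) + (\<Sum>x\<in>{x\<in>X. odd x}. (-1) ^ x)"
    unfolding parity_sum_def using assms
    by (subst sum.union_disjoint[symmetric]) (auto intro!: sum.cong)
  also have "(\<Sum>x\<in>{x\<in>X. even x}. (-1) ^ x) = int (even_count X)"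
    by (simp add: even_count_def)
  also have "(\<Sum>x\<in>{x\<in>X. odd x}. (-1) ^ x) = - int (odd_count X)"
    by (simp add: odd_count_def)
  finally show ?thesis by simp
qed

section \<open>Gluings and their gaps\<close>

text \<open>Modulo \<open>a\<close> only the multiples of \<open>m\<close> remain, and
  \<open>m\<close> is a unit there. With the next lemma: the numbers \<open>j * m\<close> for
  \<open>j < a\<close> represent each residue class modulo \<open>a\<close> exactly once.\<close>

lemma coprime_combination_unique:
  fixes a m :: nat
  assumes "coprime a m" "i < a" "j < a" "i * m + a * u = j * m + a * v"
  shows "i = j"
proof -
  have "[i * m + a * u = j * m + a * v] (mod a)" using assms(4) by simp
  then have "[i * m = j * m] (mod a)"
    by (simp add: cong_def)
  then have "[i = j] (mod a)"
    using assms(1) by (simp add: cong_mult_rcancel_nat coprime_commute)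
  then show ?thesis using assms(2,3) by (simp add: cong_def)
qed

lemma coprime_combination_exists:
  fixes a m n :: nat
  assumes "coprime a m" "a > 0"
  obtains j where "j < a" "[j * m = n] (mod a)"
proof -
  obtain x where "[m * x = Suc 0] (mod a)"
    using cong_solve_coprime_nat[of m a] assms(1) by (auto simp: coprime_commute)
  then have "[n * (m * x) = n * 1] (mod a)" by (intro cong_mult) auto
  \<comment> \<open>As \<open>x\<close> inverts \<open>m\<close> modulo \<open>a\<close>, the
    coefficient sought is \<open>n * x\<close>, reduced to lie below \<open>a\<close>.\<close>
  then have "[(n * x mod a) * m = n] (mod a)"
    by (simp add: cong_def mod_mult_right_eq ac_simps)
  then show thesis using assms(2) by (intro that[of "n * x mod a"]) auto
qed

definition gluing :: "nat \<Rightarrow> nat \<Rightarrow> nat set \<Rightarrow> nat set" where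
  "gluing a m S = {a * x + k * m | x k. x \<in> S}"

context
  fixes a m :: nat and S :: "nat set"
  assumes a_pos: "a > 0" and cop: "coprime a m"
    and add_closed: "\<And>x y. x \<in> S \<Longrightarrow> y \<in> S \<Longrightarrow> x + y \<in> S" and m_in: "m \<in> S"
begin

text \<open>The quotient of \<open>k\<close> by \<open>a\<close> can be moved into the part from
  \<open>S\<close>, because \<open>a * m\<close> is \<open>a\<close> times an element of
  \<open>S\<close>.\<close>

lemma gluing_normal_form:
  assumes "n \<in> gluing a m S"
  obtains j x where "j < a" "x \<in> S" "n = j * m + a * x"
proof -
  obtain x k where n: "n = a * x + k * m" "x \<in> S" using assms by (auto simp: gluing_def)
  have "x + i * m \<in> S" for i
  proof (induction i)
    case (Suc i)
    then show ?case using add_closed[OF m_in Suc] by (simp add: ac_simps)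
  qed (use n(2) in simp)
  moreover have "n = (k mod a) * m + a * (x + (k div a) * m)"
  proof -
    have "k * m = (k div a * a + k mod a) * m" by simp
    then show ?thesis unfolding n(1) by (simp only: algebra_simps)
  qed
  ultimately show thesis using a_pos by (intro that) auto
qed

text \<open>Let \<open>j * m\<close> be the representative of the class of \<open>n\<close> modulo
  \<open>a\<close>. If \<open>n\<close> is at least \<open>j * m\<close>, then the quotient of the
  difference by \<open>a\<close> decides membership; if \<open>n\<close> is smaller, it is always a
  gap. The bound \<open>j * m div a\<close> keeps the truncated subtraction exact.\<close>

lemma gaps_gluing:
  "gaps (gluing a m S) =
     (\<lambda>(j, x). j * m + a * x) ` ({..<a} \<times> gaps S) \<union>
     (\<lambda>(j, y). j * m - a * y) ` (SIGMA j:{..<a}. {1..j * m div a})"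
  (is "_ = ?I \<union> ?J")
proof (intro equalityI subsetI)
  fix n assume "n \<in> gaps (gluing a m S)"
  then have n: "n \<notin> gluing a m S" by (simp add: gaps_def)
  obtain j where j: "j < a" "[j * m = n] (mod a)"
    using coprime_combination_exists[OF cop a_pos] .
  show "n \<in> ?I \<union> ?J"
  proof (cases "j * m \<le> n")
    case True
    then obtain x where x: "n = j * m + a * x"
      using j(2) by (metis cong_sym cong_le_nat mult.commute add.commute)
    then have "n = a * x + j * m" by simp
    then have "x \<notin> S" using n unfolding gluing_def by blast
    then show ?thesis using x j(1) by (auto simp: gaps_def intro!: image_eqI[of _ _ "(j, x)"])
  next
    case False
    then obtain y where y: "j * m = n + a * y"
      using j(2) by (metis cong_le_nat mult.commute add.commute nat_le_linear)
    then have "y \<noteq> 0" using False by (intro notI) simp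
    moreover have "y \<le> j * m div a" using y a_pos by (simp add: less_eq_div_iff_mult_less_eq mult.commute)
    ultimately show ?thesis using y j(1) by (auto intro!: image_eqI[of _ _ "(j, y)"])
  qed
next
  fix n assume "n \<in> ?I \<union> ?J"
  then show "n \<in> gaps (gluing a m S)"
  proof
    assume "n \<in> ?I"
    then obtain j x where jx: "j < a" "x \<notin> S" "n = j * m + a * x" by (auto simp: gaps_def)
    have False if glued: "n \<in> gluing a m S"
    proof -
      obtain i z where iz: "i < a" "z \<in> S" "n = i * m + a * z" using gluing_normal_form[OF glued] .
      then have "i = j" using coprime_combination_unique[OF cop iz(1) jx(1), of z x] jx(3) by simp
      then show False using iz jx a_pos by simp
    qed
    then show ?thesis by (auto simp: gaps_def)
  next
    assume "n \<in> ?J"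
    then obtain j y where jy: "j < a" "1 \<le> y" "y \<le> j * m div a" "n = j * m - a * y" by auto
    have le: "a * y \<le> j * m" using jy(3) a_pos by (simp add: less_eq_div_iff_mult_less_eq mult.commute)
    have False if glued: "n \<in> gluing a m S"
    proof -
      obtain i z where iz: "i < a" "z \<in> S" "n = i * m + a * z" using gluing_normal_form[OF glued] .
      \<comment> \<open>Moving \<open>a * y\<close> to the left gives the shape in which uniqueness
        applies; once \<open>i = j\<close>, it forces \<open>z + y = 0\<close>, against
        \<open>1 \<le> y\<close>.\<close>
      have eq: "i * m + a * (z + y) = j * m + a * 0" using iz(3) jy(4) le by (simp add: algebra_simps)
      then have "i = j" using coprime_combination_unique[OF cop iz(1) jy(1)] by blast
      then show False using eq jy(2) a_pos by simp
    qed
    then show ?thesis by (auto simp: gaps_def)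
  qed
qed

text \<open>Both families of gaps are parametrized injectively and are disjoint, by uniqueness of
  \<open>j\<close>. The first is indexed by a full product, so its sum factors.\<close>

lemma parity_sum_gaps_gluing:
  assumes "finite (gaps S)"
  shows "parity_sum (gaps (gluing a m S)) =
     (\<Sum>j<a. (-1) ^ (j * m)) * (\<Sum>x\<in>gaps S. (-1) ^ (a * x)) +
     (\<Sum>j<a. (-1) ^ (j * m) * (\<Sum>y=1..j * m div a. (-1) ^ (a * y)))"
proof -
  let ?f = "\<lambda>(j, x). j * m + a * x" and ?g = "\<lambda>(j, y). j * m - a * y"
  let ?D = "{..<a} \<times> gaps S" and ?E = "SIGMA j:{..<a}. {1..j * m div a}"
  have le: "a * y \<le> j * m" if "(j, y) \<in> ?E" for j y
    using that a_pos by (auto simp: less_eq_div_iff_mult_less_eq mult.commute)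
  have inj_f: "inj_on ?f ?D"
  proof (rule inj_onI, clarify)
    fix i x j y
    assume i: "i < a" and j: "j < a" and eq: "i * m + a * x = j * m + a * y"
    then have "i = j" using coprime_combination_unique[OF cop] by blast
    then show "i = j \<and> x = y" using eq a_pos by simp
  qed
  have inj_g: "inj_on ?g ?E"
  proof (rule inj_onI, clarify)
    fix i u j v
    assume i: "i < a" "u \<in> {1..i * m div a}" and j: "j < a" "v \<in> {1..j * m div a}"
      and eq: "i * m - a * u = j * m - a * v"
    have "a * u \<le> i * m" "a * v \<le> j * m" using le i j by auto
    then have eq': "i * m + a * v = j * m + a * u" using eq by linarith
    then have "i = j" using coprime_combination_unique[OF cop i(1) j(1)] by blast
    then show "i = j \<and> u = v" using eq' a_pos by simp
  qed
  have disj: "?f ` ?D \<inter> ?g ` ?E = {}"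
  proof (rule ccontr)
    assume "?f ` ?D \<inter> ?g ` ?E \<noteq> {}"
    then obtain n where "n \<in> ?f ` ?D" "n \<in> ?g ` ?E" by blast
    then obtain i x j y where *: "i < a" "(j, y) \<in> ?E" "n = i * m + a * x" "n = j * m - a * y"
      by (elim imageE SigmaE) simp
    then have eq: "i * m + a * (x + y) = j * m + a * 0" using le[OF *(2)] *(3,4) by (simp add: algebra_simps)
    then have "i = j" using coprime_combination_unique[OF cop *(1)] *(2) by blast
    then show False using eq a_pos *(2) by auto
  qed
  have "parity_sum (gaps (gluing a m S)) =
      (\<Sum>n\<in>?f ` ?D. (-1) ^ n) + (\<Sum>n\<in>?g ` ?E. (-1) ^ n)"
    unfolding parity_sum_def gaps_gluing using assms disj by (intro sum.union_disjoint) auto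
  also have "(\<Sum>n\<in>?f ` ?D. (-1) ^ n) = (\<Sum>(j, x)\<in>?D. (-1) ^ (j * m) * (-1) ^ (a * x) :: int)"
    by (subst sum.reindex[OF inj_f]) (auto intro!: sum.cong simp: power_add)
  also have "\<dots> = (\<Sum>j<a. (-1) ^ (j * m)) * (\<Sum>x\<in>gaps S. (-1) ^ (a * x))"
    by (simp add: sum_product sum.cartesian_product)
  also have "(\<Sum>n\<in>?g ` ?E. (-1) ^ n) = (\<Sum>(j, y)\<in>?E. (-1) ^ (j * m) * (-1) ^ (a * y) :: int)"
  proof (subst sum.reindex[OF inj_g], rule sum.cong[OF refl], clarify)
    fix j y assume "j < a" "y \<in> {1..j * m div a}"
    \<comment> \<open>Since the subtraction does not truncate, the difference has the parity of the
      sum, and the sign splits.\<close>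
    then have "a * y \<le> j * m" using le by auto
    then show "((\<lambda>n. (-1) ^ n) \<circ> ?g) (j, y) = ((-1) ^ (j * m) * (-1) ^ (a * y) :: int)"
      by (simp add: minus_one_power_iff)
  qed
  also have "\<dots> = (\<Sum>j<a. (-1) ^ (j * m) * (\<Sum>y=1..j * m div a. (-1) ^ (a * y)))"
    by (subst sum.Sigma[symmetric]) (auto simp: sum_distrib_left)
  finally show ?thesis .
qed

end

section \<open>Two coprime generators and the recurrence\<close>

text \<open>The two remainders modulo \<open>a\<close> are nonzero and add up to a multiple of
  \<open>a\<close> below \<open>2 * a\<close>, hence to \<open>a\<close> itself; the quotients then
  share the remaining \<open>m - 1\<close>.\<close>

lemma div_add_div_complement:
  fixes a m j :: nat
  assumes "coprime a m" "0 < j" "j < a"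
  shows "j * m div a + (a - j) * m div a + 1 = m"
proof -
  \<comment> \<open>Otherwise \<open>a\<close> would divide \<open>j\<close> by coprimality, but
    \<open>0 < j < a\<close>.\<close>
  have "\<not> a dvd j * m"
    using assms by (auto simp: coprime_dvd_mult_left_iff dest: dvd_imp_le)
  then have "\<not> a dvd (a - j) * m"
    using assms by (auto simp: coprime_dvd_mult_left_iff dest: dvd_imp_le)
  let ?q = "j * m div a" and ?r = "(a - j) * m div a"
  have r: "0 < j * m mod a" "0 < (a - j) * m mod a" "j * m mod a < a" "(a - j) * m mod a < a"
    using \<open>\<not> a dvd j * m\<close> \<open>\<not> a dvd (a - j) * m\<close> assms by (auto simp: mod_greater_zero_iff_not_dvd)
  have "j * m + (a - j) * m = a * m"
    using assms(3) by (simp add: add_mult_distrib[symmetric])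
  then have *: "a * (?q + ?r) + (j * m mod a + (a - j) * m mod a) = a * m"
    using mult_div_mod_eq[of a "j * m"] mult_div_mod_eq[of a "(a - j) * m"]
    unfolding distrib_left by linarith
  have "a * (?q + ?r) < a * m" using * r by linarith
  moreover have "a * m < a * (?q + ?r + 2)" using * r unfolding distrib_left by linarith
  ultimately have "?q + ?r < m" "m < ?q + ?r + 2" by (simp_all only: mult_less_cancel1)
  then show ?thesis by simp
qed

text \<open>The reflection of \<open>j\<close> to \<open>a - j\<close> permutes
  \<open>{1..<a}\<close>; the index \<open>0\<close> has no partner, so its term must
  vanish.\<close>

lemma double_sum_complement:
  fixes h :: "nat \<Rightarrow> int"
  assumes "h 0 = 0"
  shows "2 * (\<Sum>j<a. h j) = (\<Sum>j=1..<a. h j + h (a - j))"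
proof -
  have "(\<Sum>j<a. h j) = (\<Sum>j=1..<a. h j)"
    using assms by (intro sum.mono_neutral_right) (auto simp: Suc_le_eq intro: gr0I)
  moreover have "(\<Sum>j=1..<a. h j) = (\<Sum>j=1..<a. h (a - j))"
    by (rule sum.reindex_bij_witness[of _ "\<lambda>j. a - j" "\<lambda>j. a - j"]) auto
  ultimately show ?thesis by (simp add: sum.distrib)
qed

lemma sum_alternating: "(\<Sum>j<n. (-1) ^ j) = (of_bool (odd n) :: int)"
  by (induction n) auto

lemma sum_alternating_from_1: "(\<Sum>y=Suc 0..n. (-1) ^ y) = - (of_bool (odd n) :: int)"
  by (induction n) auto

text \<open>The sum is $\Delta$ for the semigroup generated by $a$ and $m$; it is evaluated by pairing
  $j$ with $a - j$.\<close>

lemma parity_sum_coprime_pair: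
  fixes a m :: nat
  assumes "coprime a m" "a > 0"
  shows "2 * (\<Sum>j<a. (-1) ^ (j * m) * (\<Sum>y=1..j * m div a. (-1) ^ (a * y))) =
    (if even a then 1 - int m else if even m then 1 - int a else 0)" (is "2 * (\<Sum>j<a. ?h j) = _")
proof -
  have double: "2 * (\<Sum>j<a. ?h j) = (\<Sum>j=1..<a. ?h j + ?h (a - j))"
    by (rule double_sum_complement) simp
  \<comment> \<open>For odd \<open>a\<close> the inner sum alternates from -1, so it is -1 or 0
    according to the parity of its length.\<close>
  have h_odd: "?h i = - ((-1) ^ (i * m) * of_bool (odd (i * m div a)))" if "odd a" for i
    using that sum_alternating_from_1[of "i * m div a"] by (simp add: power_mult)
  consider "even a" "odd m" | "odd a" "even m" | "odd a" "odd m"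
    using assms(1) by (metis coprime_common_divisor odd_one)
  then show ?thesis
  proof cases
    case 1
    \<comment> \<open>For even \<open>a\<close> every inner term is 1, so the inner sum is the
      quotient itself; \<open>j\<close> and \<open>a - j\<close> carry the same sign.\<close>
    have "?h j + ?h (a - j) = (-1) ^ j * (int m - 1)" if j: "j \<in> {1..<a}" for j
    proof -
      have "int (j * m div a) + int ((a - j) * m div a) = int m - 1"
        using div_add_div_complement[OF assms(1), of j] j by simp
      moreover have "even (a - j) = even j" using 1 j by auto
      ultimately show ?thesis using 1 by (cases "even j") (auto simp: minus_one_power_iff)
    qed
    then have "2 * (\<Sum>j<a. ?h j) = (\<Sum>j=1..<a. (-1) ^ j) * (int m - 1)"
      unfolding double by (simp add: sum_distrib_right)
    moreover have "(\<Sum>j=1..<a. (-1) ^ j) = (-1 :: int)"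
    proof -
      \<comment> \<open>Over all \<open>j < a\<close> the signs cancel since \<open>a\<close> is
        even; dropping \<open>j = 0\<close> leaves -1.\<close>
      have "(\<Sum>j<a. (-1) ^ j) = 1 + (\<Sum>j=1..<a. (-1) ^ j :: int)"
        using assms(2) by (subst lessThan_atLeast0, subst sum.atLeast_Suc_lessThan) auto
      then show ?thesis using 1 sum_alternating[of a] by simp
    qed
    ultimately show ?thesis using 1 by simp
  next
    case 2
    \<comment> \<open>All outer signs are 1, and the quotients have the odd sum
      \<open>m - 1\<close>, so exactly one of them is odd.\<close>
    have "?h j + ?h (a - j) = -1" if j: "j \<in> {1..<a}" for j
    proof -
      have "j * m div a + (a - j) * m div a + 1 = m"
        using div_add_div_complement[OF assms(1), of j] j by simp
      then have "odd (j * m div a) \<longleftrightarrow> even ((a - j) * m div a)"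
        using 2 by (metis even_add odd_one)
      then show ?thesis using 2 unfolding h_odd[OF 2(1)] by (simp add: minus_one_power_iff)
    qed
    then show ?thesis unfolding double using 2 assms(2) by simp
  next
    case 3
    \<comment> \<open>The quotients have the even sum \<open>m - 1\<close>, hence equal parity,
      while the outer signs are opposite.\<close>
    have "?h j + ?h (a - j) = 0" if j: "j \<in> {1..<a}" for j
    proof -
      have "j * m div a + (a - j) * m div a + 1 = m"
        using div_add_div_complement[OF assms(1), of j] j by simp
      then have "odd (j * m div a) \<longleftrightarrow> odd ((a - j) * m div a)"
        using 3 by (metis even_add odd_one)
      moreover have "even (a - j) = odd j" using 3 j by auto
      ultimately show ?thesis using 3 unfolding h_odd[OF 3(1)] by (simp add: minus_one_power_iff)
    qed
    then show ?thesis unfolding double using 3 by simp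
  qed
qed

text \<open>The factor multiplying the sum over the gaps of \<open>S\<close> is a sum of
  \<open>a\<close> signs: it is 0 for even \<open>a\<close> (then \<open>m\<close> is odd),
  \<open>a\<close> for even \<open>m\<close>, and 1 if both are odd. For odd \<open>a\<close>,
  \<open>a * x\<close> has the parity of \<open>x\<close>.\<close>

lemma double_parity_sum_gaps_gluing:
  assumes "a > 0" "coprime a m" "m \<in> S" "finite (gaps S)"
    and "\<And>x y. x \<in> S \<Longrightarrow> y \<in> S \<Longrightarrow> x + y \<in> S"
  shows "2 * parity_sum (gaps (gluing a m S)) =
    (if even a then 1 - int m
     else if even m then 2 * int a * parity_sum (gaps S) + 1 - int a
     else 2 * parity_sum (gaps S))"
proof -
  have m_odd: "odd m" if "even a" using that assms(2) by (metis coprime_common_divisor odd_one)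
  have "(\<Sum>j<a. (-1) ^ (j * m)) = (if even m then int a else of_bool (odd a))"
    using sum_alternating[of a] by (simp add: power_mult mult.commute[of _ m])
  moreover have "(\<Sum>x\<in>gaps S. (-1) ^ (a * x)) = parity_sum (gaps S)" if "odd a"
    using that by (simp add: power_mult parity_sum_def)
  ultimately show ?thesis
    using parity_sum_gaps_gluing[OF assms(1,2,5,3,4)] parity_sum_coprime_pair[OF assms(2,1)] m_odd
    by (simp add: distrib_left)
qed

section \<open>Compound sequences as iterated gluings\<close>

lemma generated_snoc: "generated (ns @ [n]) = {x + k * n | x k. x \<in> generated ns}"
proof (intro equalityI subsetI)
  fix z assume "z \<in> generated (ns @ [n])"
  then obtain c where "z = (\<Sum>i<Suc (length ns). c i * (ns @ [n]) ! i)"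
    by (auto simp: generated_def)
  then have "z = (\<Sum>i<length ns. c i * ns ! i) + c (length ns) * n"
    by (simp add: nth_append)
  then show "z \<in> {x + k * n | x k. x \<in> generated ns}" by (auto simp: generated_def)
next
  fix z assume "z \<in> {x + k * n | x k. x \<in> generated ns}"
  then obtain c k where "z = (\<Sum>i<length ns. c i * ns ! i) + k * n" by (auto simp: generated_def)
  then have "z = (\<Sum>i<length (ns @ [n]). (c(length ns := k)) i * (ns @ [n]) ! i)"
    by (simp add: nth_append)
  then show "z \<in> generated (ns @ [n])" unfolding generated_def by blast
qed

lemma generated_map_mult: "generated (map ((*) a) ns) = (*) a ` generated ns"
proof -
  have "(\<Sum>i<length (map ((*) a) ns). c i * map ((*) a) ns ! i) = a * (\<Sum>i<length ns. c i * ns ! i)"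
    for c by (simp add: sum_distrib_left ac_simps)
  then show ?thesis unfolding generated_def by auto
qed

text \<open>The last index of the first list is at least every index of the second, so suitability
  makes \<open>a\<close> coprime to each entry of \<open>B @ [b]\<close>, hence to their
  product.\<close>

lemma suitable_pair_snocD:
  assumes "suitable_pair (A @ [a]) (B @ [b])"
  shows "suitable_pair A B" "a > 0" "coprime a (prod_list (B @ [b]))"
proof -
  have len: "length A = length B" using assms by (simp add: suitable_pair_def)
  have cop: "coprime ((A @ [a]) ! i) ((B @ [b]) ! j)" if "j \<le> i" "i \<le> length A" for i j
    using assms that by (auto simp: suitable_pair_def)
  have "coprime (A ! i) (B ! j)" if "i < length A" "j \<le> i" for i j
    using cop[of j i] that len by (simp add: nth_append)
  then show "suitable_pair A B" using assms by (auto simp: suitable_pair_def)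
  show "a > 0" using assms by (simp add: suitable_pair_def)
  have "coprime a x" if x: "x \<in> set (B @ [b])" for x
  proof -
    obtain j where "j < length (B @ [b])" "(B @ [b]) ! j = x" using x by (metis in_set_conv_nth)
    moreover from this have "j \<le> length A" using len by simp
    ultimately show ?thesis using cop[of j "length A"] by (metis nth_append_length order_refl)
  qed
  then show "coprime a (prod_list (B @ [b]))"
    by (rule prod_list_coprime_right)
qed

text \<open>In the closed form of the terms, each old term gains the factor \<open>a\<close> from
  the lengthened tail; the one new term has an empty tail.\<close>

lemma compound_sequence_snoc:
  assumes "suitable_pair (A @ [a]) (B @ [b])"
  shows "compound_sequence (A @ [a]) (B @ [b]) =
    map ((*) a) (compound_sequence A B) @ [prod_list (B @ [b])]"
proof -
  have len: "length A = length B" using assms by (simp add: suitable_pair_def)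
  have "compound_term (A @ [a]) (B @ [b]) i = a * compound_term A B i" if "i \<le> length A" for i
    using compound_term_eq[OF assms, of i] compound_term_eq[OF suitable_pair_snocD(1)[OF assms], of i]
      that len by simp
  moreover have "compound_term (A @ [a]) (B @ [b]) (Suc (length A)) = prod_list (B @ [b])"
    using compound_term_eq[OF assms, of "Suc (length A)"] len by simp
  ultimately show ?thesis
    by (simp add: compound_sequence_def del: compound_term.simps)
qed

lemma generated_compound_sequence_snoc:
  assumes "suitable_pair (A @ [a]) (B @ [b])"
  shows "generated (compound_sequence (A @ [a]) (B @ [b])) =
    gluing a (prod_list (B @ [b])) (generated (compound_sequence A B))"
  unfolding compound_sequence_snoc[OF assms] generated_snoc generated_map_mult gluing_def by auto

text \<open>These are the first and the last term. The last one yields the membership required for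
  gluing; together they carry the parity of all entries.\<close>

lemma prod_list_ends_mem_compound_sequence:
  assumes "suitable_pair A B"
  shows "prod_list A \<in> set (compound_sequence A B)" "prod_list B \<in> set (compound_sequence A B)"
proof -
  have "compound_term A B i \<in> set (compound_sequence A B)" if "i \<le> length A" for i
    using that by (auto simp: compound_sequence_def simp del: upt_Suc)
  from this[of 0] this[of "length A"] show
    "prod_list A \<in> set (compound_sequence A B)" "prod_list B \<in> set (compound_sequence A B)"
    using compound_term_eq[OF assms, of "length A"] assms by (auto simp: suitable_pair_def)
qed

section \<open>Induction on the length and the equivalences\<close>

lemma odd_prod_list_iff: "odd (prod_list xs) \<longleftrightarrow> (\<forall>x\<in>set xs. odd (x :: nat))"
  by (induction xs) auto

lemma prod_list_gt_1: "xs \<noteq> [] \<Longrightarrow> \<forall>x\<in>set xs. x > 1 \<Longrightarrow> prod_list xs > (1 :: nat)"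
  by (induction xs rule: list_nonempty_induct) (auto intro: one_less_mult)

text \<open>In the recurrence, an even \<open>a\<close> or an even product makes the value strictly
  negative, as both exceed 1. If both are odd, the value and the parity condition are those of the
  shorter pair.\<close>

lemma parity_sum_gaps_compound:
  assumes "suitable_pair A B" "\<forall>a\<in>set A. a > 1" "\<forall>b\<in>set B. b > 1"
  shows "parity_sum (gaps (generated (compound_sequence A B))) \<le> 0 \<and>
    (parity_sum (gaps (generated (compound_sequence A B))) = 0 \<longleftrightarrow>
      (\<forall>a\<in>set A. odd a) \<and> (\<forall>b\<in>set B. odd b))"
  using assms
proof (induction A arbitrary: B rule: rev_induct)
  case Nil
  \<comment> \<open>The empty pair has compound sequence \<open>[1]\<close>, which generates
    everything and leaves no gaps.\<close>
  have "x \<in> generated [1]" for x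
    using generated_mult[of 1 "[1]" x] set_subset_generated[of "[1]"] by simp
  then have "gaps (generated [1]) = {}" by (auto simp: gaps_def)
  then show ?case using Nil by (simp add: suitable_pair_def compound_sequence_def parity_sum_def)
next
  case (snoc a A B')
  then obtain B b where B': "B' = B @ [b]"
    by (metis suitable_pair_def length_0_conv snoc_eq_iff_butlast)
  note AB = snoc.prems(1)[unfolded B']
  let ?S = "generated (compound_sequence A B)" and ?m = "prod_list (B @ [b])"
  let ?D = "parity_sum (gaps ?S)" and ?D' = "parity_sum (gaps (generated (compound_sequence (A @ [a]) B')))"
  have IH: "?D \<le> 0" "?D = 0 \<longleftrightarrow> (\<forall>a\<in>set A. odd a) \<and> (\<forall>b\<in>set B. odd b)"
    using snoc.IH[OF suitable_pair_snocD(1)[OF AB]] snoc.prems B' by auto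
  \<comment> \<open>The last term of the shorter sequence is \<open>prod_list B\<close>, and
    \<open>?m\<close> is \<open>b\<close> times it.\<close>
  have "?m \<in> ?S"
    using prod_list_ends_mem_compound_sequence(2)[OF suitable_pair_snocD(1)[OF AB]]
      set_subset_generated generated_mult[of "prod_list B" _ b] by (auto simp: mult.commute)
  then have D': "2 * ?D' = (if even a then 1 - int ?m
     else if even ?m then 2 * int a * ?D + 1 - int a else 2 * ?D)"
    unfolding B' generated_compound_sequence_snoc[OF AB]
    by (intro double_parity_sum_gaps_gluing suitable_pair_snocD[OF AB] generated_add
        finite_gaps_compound)
  have m: "?m > 1" using snoc.prems(3) B' by (intro prod_list_gt_1) auto
  have a: "a > 1" using snoc.prems(2) by simp
  have aD: "int a * ?D \<le> 0" using IH(1) by (simp add: mult_nonneg_nonpos)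
  have B'_odd: "odd ?m \<longleftrightarrow> (\<forall>b\<in>set B'. odd b)" unfolding B' by (rule odd_prod_list_iff)
  consider "even a" | "odd a" "even ?m" | "odd a" "odd ?m" by blast
  then show ?case
  proof cases
    case 1
    then have "?D' < 0" using D' m by (simp del: prod_list.append)
    then show ?thesis using 1 by auto
  next
    case 2
    then have "2 * ?D' = 2 * (int a * ?D) + 1 - int a" using D' by simp
    then have "?D' < 0" using aD a by linarith
    then show ?thesis using 2 B'_odd by auto
  next
    case 3
    then have "?D' = ?D" using D' by simp
    then show ?thesis using 3 B'_odd IH by (auto simp: B')
  qed
qed

text \<open>Odd end terms force odd entries; conversely every term is a product of entries.\<close>

lemma odd_compound_sequence_iff:
  assumes "suitable_pair A B"
  shows "(\<forall>n\<in>set (compound_sequence A B). odd n) \<longleftrightarrow> (\<forall>a\<in>set A. odd a) \<and> (\<forall>b\<in>set B. odd b)"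
proof
  assume "\<forall>n\<in>set (compound_sequence A B). odd n"
  then show "(\<forall>a\<in>set A. odd a) \<and> (\<forall>b\<in>set B. odd b)"
    using prod_list_ends_mem_compound_sequence[OF assms] odd_prod_list_iff by blast
next
  assume odd: "(\<forall>a\<in>set A. odd a) \<and> (\<forall>b\<in>set B. odd b)"
  have "odd (prod_list (take i B) * prod_list (drop i A))" for i
    using odd odd_prod_list_iff[of "take i B"] odd_prod_list_iff[of "drop i A"]
    by (auto dest: in_set_takeD in_set_dropD)
  then show "\<forall>n\<in>set (compound_sequence A B). odd n"
    by (auto simp: compound_sequence_def compound_term_eq[OF assms] less_Suc_eq_le
        simp del: upt_Suc compound_term.simps)
qed

theorem corollary3p12:
  fixes A B :: "nat list" and S :: "nat set"
  assumes "suitable_pair A B"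
    and "\<forall>a\<in>set A. a > 1" and "\<forall>b\<in>set B. b > 1"
    and "S = generated (compound_sequence A B)"
  shows "odd_count (gaps S) \<ge> even_count (gaps S) \<and>
    (odd_count (gaps S) = even_count (gaps S) \<longleftrightarrow>
       (\<forall>n\<in>set (compound_sequence A B). odd n)) \<and>
    ((\<forall>n\<in>set (compound_sequence A B). odd n) \<longleftrightarrow>
       (\<forall>a\<in>set A. odd a) \<and> (\<forall>b\<in>set B. odd b))"
  \<comment> \<open>The gaps being finite, \<open>parity_sum\<close> is the difference of the two
    counts, so its sign and its vanishing give the inequality and the case of equality.\<close>
  using parity_sum_gaps_compound[OF assms(1-3)]
  unfolding odd_compound_sequence_iff[OF assms(1)] assms(4)
    parity_sum_eq[OF finite_gaps_compound[OF assms(1)]]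
  by linarith

end
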